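(* Let $\mu_n$ ($n\geq 1$) and $\mu$ be probability measures on a complete separable metric space $(M,d)$, and let $c:M\times M\to\mathbf{R}$ be such that $c(x,y)=C(d(x,y))$, where $C:[0,+\infty)\to[0,+\infty)$ is a non-decreasing continuous function with $C(0)=0$. Suppose that $$\int C(2d(x,a))\,\mu_n(dx)<\infty\ \text{ for all } n,\qquad \int C(2d(x,a))\,\mu(dx)<\infty$$ for some (and, therefore, for all) $a\in M$. Consider the conditions (a) $\mu_n\Longrightarrow\mu$; (b) $\int C(2d(x,a))\,\mu_n(dx)\to\int C(2d(x,a))\,\mu(dx)$ as $n\to\infty$. Then: 1. If (a) and (b) hold, then $T_c(\mu_n,\mu)\to 0$. 2. Conversely, if $T_c(\mu_n,\mu)\to 0$, then $\mu_n\Longrightarrow\mu$. 3. If, additionally, $C$ satisfies a doubling condition, i.e. there exists a positive constant $\lambda$ such that $C(2y)\leq\lambda C(y)$ for all $y\geq 0$, then $T_c(\mu_n,\mu)\to 0$ if and only if both (a) and (b) hold.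
   Context: For probability measures $\mu,\nu$ on the Borel $\sigma$-field $\mathcal{B}(M)$ of a metric space $(M,d)$ and a non-negative Borel function $c:M\times M\to\mathbf{R}$, the transportation $c$-distance is $T_c(\mu,\nu)=\inf_{\pi\in\Pi}\int c(x,y)\,d\pi(x,y)$, where $\Pi$ is the set of all probability measures on $\mathcal{B}(M\times M)$ with marginals $\mu$ and $\nu$; equivalently, $T_c(\mu,\nu)=\inf \mathbf{E}\,c(X,Y)$ over all pairs of $M$-valued random elements $X,Y$ on a common probability space with distributions $\mu$ and $\nu$, respectively. The symbol $\Longrightarrow$ denotes weak convergence of probability measures.
   Formalization: Part 2 assumes C(t)>0 for all t>0 and part 3 assumes C is not identically zero (both converses fail for C=0); the parenthesis "therefore, for all a" is proved only under doubling, as it fails e.g. for C(t)=exp(t^2)-1. *)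

theory Defs
  imports "HOL-Probability.Probability"
begin

text \<open>
  The library's \<open>weak_conv_m\<close> only covers measures on the real line.
\<close>

definition converges_weakly ::
    "(nat \<Rightarrow> 'a::topological_space measure) \<Rightarrow> 'a measure \<Rightarrow> bool" where
  "converges_weakly \<mu> \<nu> \<longleftrightarrow>
     (\<forall>f :: 'a \<Rightarrow> real. continuous_on UNIV f \<longrightarrow> bounded (range f) \<longrightarrow>
        (\<lambda>n. \<integral>x. f x \<partial>\<mu> n) \<longlonglongrightarrow> (\<integral>x. f x \<partial>\<nu>))"

definition couplings ::
    "'a::topological_space measure \<Rightarrow> 'a measure \<Rightarrow> ('a \<times> 'a) measure set" where
  "couplings \<mu> \<nu> =
     {\<pi>. prob_space \<pi> \<and> sets \<pi> = sets borel \<and>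
         distr \<pi> borel fst = \<mu> \<and> distr \<pi> borel snd = \<nu>}"

text \<open>
  Only meant for non-negative \<open>c\<close>, since \<open>ennreal\<close> truncates negative values to \<open>0\<close>.
\<close>

definition transport_dist ::
    "('a::topological_space \<Rightarrow> 'a \<Rightarrow> real) \<Rightarrow> 'a measure \<Rightarrow> 'a measure \<Rightarrow> ennreal" where
  "transport_dist c \<mu> \<nu> =
     (INF \<pi> \<in> couplings \<mu> \<nu>. \<integral>\<^sup>+ p. ennreal (c (fst p) (snd p)) \<partial>\<pi>)"

definition double_moment ::
    "(real \<Rightarrow> real) \<Rightarrow> 'a::metric_space \<Rightarrow> 'a measure \<Rightarrow> ennreal" where
  "double_moment C a \<mu> = (\<integral>\<^sup>+ x. ennreal (C (2 * dist x a)) \<partial>\<mu>)"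

definition doubling :: "(real \<Rightarrow> real) \<Rightarrow> bool" where
  "doubling C \<longleftrightarrow> (\<exists>l>0. \<forall>y\<ge>0. C (2 * y) \<le> l * C y)"

end

theory Submission
  imports Defs
begin

text \<open>
  Write \<open>T\<close> for the transportation distance with cost \<open>c x y = C (dist x y)\<close>, and
  \<open>g x = C (2 * dist x a)\<close>. Since one of \<open>dist x a\<close>, \<open>dist y a\<close> is at least half of
  \<open>dist x y\<close>, the cost satisfies \<open>c x y \<le> g x + g y\<close>; this is what links \<open>T\<close> to the moment.

  From (a) and (b) to \<open>T \<longlonglongrightarrow> 0\<close>. Take a continuous partition of unity \<open>f 0, f 1, \<dots>\<close> whose
  members have supports of small diameter. Two probability measures \<open>M\<close>, \<open>N\<close> can share the mass
  \<open>min (\<integral>f i \<partial>M) (\<integral>f i \<partial>N)\<close> inside the support of each \<open>f i\<close> with \<open>i < k\<close>, at cost at most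
  \<open>C\<close> of the diameter. The leftover parts of \<open>M\<close> and \<open>N\<close> are coupled independently, and there the
  cost is at most the \<open>g\<close>-moment of the two leftovers. This is a coupling with an explicit density
  with respect to \<open>M \<Otimes>\<^sub>M N\<close>. For \<open>M = \<mu> n\<close>, \<open>N = \<nu>\<close> the bound
  (\<open>transport_dist_le_overlap\<close>) consists of the integrals of \<open>f i\<close>, of the functions \<open>g * f i\<close>,
  which are bounded and continuous since \<open>f i\<close> has bounded support, and of \<open>g\<close> itself. So (a) and (b)
  make it converge, to \<open>C\<close> of the diameter plus twice the \<open>g\<close>-moment of \<open>\<nu>\<close> weighted by
  \<open>1 - (\<Sum>i<k. f i)\<close>. Dominated convergence in \<open>k\<close> makes the latter small.

  From \<open>T \<longlonglongrightarrow> 0\<close> back to integrals, for \<open>C\<close> positive on the positive reals. Let \<open>f\<close> be continuous with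
  \<open>\<bar>f x - f y\<bar> \<le> G y + K * c x y\<close> for some \<open>\<nu>\<close>-integrable \<open>G\<close>. Then for every \<open>e > 0\<close> one has
  \<open>\<bar>f x - f y\<bar> \<le> e + H y + L * c x y\<close> with \<open>\<integral>H \<partial>\<nu> < e\<close> and a constant \<open>L\<close>. Integrating over a
  nearly optimal coupling gives \<open>\<integral>f \<partial>\<mu> n \<longlonglongrightarrow> \<integral>f \<partial>\<nu>\<close>
  (\<open>integral_tendsto_if_transport_dist_tendsto_0\<close>). A bounded \<open>f\<close> satisfies the
  hypothesis with \<open>G\<close> constant and \<open>K = 0\<close>, which is weak convergence. Under the doubling
  condition, \<open>f = g\<close> satisfies it with \<open>G\<close> a multiple of \<open>g\<close>, which is (b);
  there the positivity of \<open>C\<close> follows from \<open>C\<close> not being identically zero.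
\<close>

section \<open>Integrals along couplings of vanishing cost\<close>

lemma continuous_on_compose_half_line:
  assumes C: "continuous_on {0..} (C :: real \<Rightarrow> real)"
    and h: "continuous_on S h" "\<And>x. x \<in> S \<Longrightarrow> 0 \<le> h x"
  shows "continuous_on S (\<lambda>x. C (h x))"
  by (rule continuous_on_compose2[OF C h(1)]) (use h(2) in auto)

lemma integrable_if_bounded_continuous:
  fixes f :: "'a::topological_space \<Rightarrow> real"
  assumes "prob_space M" "sets M = sets borel" "continuous_on UNIV f" "\<And>x. \<bar>f x\<bar> \<le> B"
  shows "integrable M f"
proof -
  interpret prob_space M by fact
  have "f \<in> borel_measurable M"
    unfolding measurable_cong_sets[OF assms(2) refl]
    by (rule borel_measurable_continuous_onI[OF assms(3)])
  then show ?thesis using assms(4) by (intro integrable_const_bound[where B=B]) auto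
qed

lemma measurable_fst_snd_coupling:
  assumes "\<pi> \<in> couplings \<mu> \<nu>"
  shows "fst \<in> measurable \<pi> borel" "snd \<in> measurable \<pi> borel"
proof -
  have "sets \<pi> = sets borel" using assms by (simp add: couplings_def)
  then have "measurable \<pi> borel = (borel_measurable borel :: ('a \<times> 'a \<Rightarrow> 'a) set)"
    by (rule measurable_cong_sets) simp
  then show "fst \<in> measurable \<pi> borel" "snd \<in> measurable \<pi> borel"
    by (auto intro!: borel_measurable_continuous_onI continuous_intros)
qed

lemma coupling_marginal_integral:
  fixes f :: "'a::topological_space \<Rightarrow> real"
  assumes \<pi>: "\<pi> \<in> couplings \<mu> \<nu>" and f: "f \<in> borel_measurable borel"
  shows "(\<integral>p. f (fst p) \<partial>\<pi>) = (\<integral>x. f x \<partial>\<mu>)"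
    and "(\<integral>p. f (snd p) \<partial>\<pi>) = (\<integral>x. f x \<partial>\<nu>)"
    and "integrable \<mu> f \<Longrightarrow> integrable \<pi> (\<lambda>p. f (fst p))"
    and "integrable \<nu> f \<Longrightarrow> integrable \<pi> (\<lambda>p. f (snd p))"
proof -
  have d: "distr \<pi> borel fst = \<mu>" "distr \<pi> borel snd = \<nu>"
    using \<pi> by (auto simp: couplings_def)
  note m = measurable_fst_snd_coupling[OF \<pi>]
  show "(\<integral>p. f (fst p) \<partial>\<pi>) = (\<integral>x. f x \<partial>\<mu>)"
    using integral_distr[OF m(1) f] d by simp
  show "(\<integral>p. f (snd p) \<partial>\<pi>) = (\<integral>x. f x \<partial>\<nu>)"
    using integral_distr[OF m(2) f] d by simp
  show "integrable \<mu> f \<Longrightarrow> integrable \<pi> (\<lambda>p. f (fst p))"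
    using integrable_distr_eq[OF m(1) f] d by simp
  show "integrable \<nu> f \<Longrightarrow> integrable \<pi> (\<lambda>p. f (snd p))"
    using integrable_distr_eq[OF m(2) f] d by simp
qed

text \<open>
  The hypothesis \<open>bound\<close> improves to \<open>\<bar>f x - f y\<bar> \<le> e + H y + L * C (dist x y)\<close> with
  \<open>\<integral>H \<partial>\<nu> < e\<close>. Call \<open>y\<close> good if \<open>G y \<le> k\<close> and if moving \<open>y\<close> by less than \<open>1 / Suc k\<close> changes \<open>f\<close>
  by at most \<open>e\<close>. For good \<open>y\<close> no \<open>H\<close> is used: \<open>e\<close> suffices if \<open>x\<close> is that close to \<open>y\<close>, and
  otherwise \<open>C (dist x y)\<close> is bounded below, so that a fixed multiple of it is at least \<open>k\<close>. For the other \<open>y\<close>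
  put \<open>H y = G y\<close>. By continuity of \<open>f\<close> these \<open>y\<close> disappear as \<open>k\<close> grows, so that \<open>\<integral>H \<partial>\<nu>\<close> becomes
  small. As \<open>H\<close> depends on \<open>y\<close> only, its integral is the same for all couplings.
\<close>

lemma integral_tendsto_if_transport_dist_tendsto_0:
  fixes \<mu> :: "nat \<Rightarrow> 'a::metric_space measure" and f G :: "'a \<Rightarrow> real"
  assumes \<nu>: "sets \<nu> = sets borel"
    and mono: "mono_on {0..} C" and cont: "continuous_on {0..} C"
    and C0: "C 0 = 0" and pos: "\<And>t. t > 0 \<Longrightarrow> C t > 0"
    and T: "(\<lambda>n. transport_dist (\<lambda>x y. C (dist x y)) (\<mu> n) \<nu>) \<longlonglongrightarrow> 0"
    and f: "continuous_on UNIV f"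
    and f\<mu>: "\<And>n. n \<ge> 1 \<Longrightarrow> integrable (\<mu> n) f" and f\<nu>: "integrable \<nu> f"
    and G: "integrable \<nu> G" "\<And>y. G y \<ge> 0" and K: "K \<ge> 0"
    and bound: "\<And>x y. \<bar>f x - f y\<bar> \<le> G y + K * C (dist x y)"
  shows "(\<lambda>n. \<integral>x. f x \<partial>\<mu> n) \<longlonglongrightarrow> (\<integral>x. f x \<partial>\<nu>)"
proof (rule tendstoI)
  fix e' :: real assume "e' > 0"
  define e where "e = e' / 4"
  have e: "e > 0" "3 * e < e'" using \<open>e' > 0\<close> by (auto simp: e_def)
  have Cnn: "C t \<ge> 0" if "t \<ge> 0" for t using that pos[of t] C0 by (cases "t = 0") auto
  have [measurable]: "f \<in> borel_measurable borel"
    by (rule borel_measurable_continuous_onI[OF f])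
  have Gm: "G \<in> borel_measurable borel"
    using G(1) measurable_cong_sets[OF \<nu> refl] by (auto dest!: borel_measurable_integrable)
  note [measurable] = Gm
  \<comment> \<open>The points at which radius \<open>1 / Suc k\<close> is small enough for
  the continuity of \<open>f\<close> with tolerance \<open>e\<close>.\<close>
  define U where "U k = {y. \<forall>x. dist x y < 1 / Suc k \<longrightarrow> \<bar>f x - f y\<bar> \<le> e}" for k
  have "closed (U k)" for k
  proof -
    have "- U k = (\<Union>x. {y. dist x y < 1 / Suc k} \<inter> {y. e < \<bar>f x - f y\<bar>})"
      by (auto simp: U_def not_le)
    moreover have "open \<dots>"
      by (intro open_UN ballI open_Int open_Collect_less continuous_intros f)
    ultimately show ?thesis by (simp add: closed_def)
  qed
  then have Um[measurable]: "U k \<in> sets borel" for k by auto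
  define H where "H k y = (if y \<in> U k \<and> G y \<le> real k then 0 else G y)" for k y
  have Hm: "H k \<in> borel_measurable borel" for k
    unfolding H_def by measurable
  have H\<nu>: "H k \<in> borel_measurable \<nu>" for k
    using Hm measurable_cong_sets[OF \<nu> refl] by auto
  have Hle: "0 \<le> H k y" "H k y \<le> G y" for k y using G(2) by (auto simp: H_def)
  have Hint: "integrable \<nu> (H k)" for k
    by (rule Bochner_Integration.integrable_bound[OF G(1) H\<nu>]) (use Hle G(2) in auto)
  have "(\<lambda>k. \<integral>y. H k y \<partial>\<nu>) \<longlonglongrightarrow> (\<integral>y. 0 \<partial>\<nu>)"
  proof (rule integral_dominated_convergence[OF _ H\<nu> G(1)])
    show "AE y in \<nu>. (\<lambda>k. H k y) \<longlonglongrightarrow> 0"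
    proof (rule AE_I2)
      fix y
      have "isCont f y" using f by (simp add: continuous_on_eq_continuous_at)
      then obtain r where r: "r > 0" "\<And>x. dist x y < r \<Longrightarrow> \<bar>f x - f y\<bar> < e"
        unfolding continuous_at_eps_delta using e by (metis dist_real_def)
      have "\<forall>\<^sub>F k in sequentially. 1 / Suc k < r"
        using r(1) LIMSEQ_inverse_real_of_nat
        by (auto simp: inverse_eq_divide dest!: order_tendstoD(2))
      moreover have "\<forall>\<^sub>F k in sequentially. G y \<le> real k"
        using filterlim_real_sequentially by (auto simp: filterlim_at_top)
      ultimately have "\<forall>\<^sub>F k in sequentially. H k y = 0"
      proof eventually_elim
        case (elim k)
        have "y \<in> U k" unfolding U_def using elim r(2) by (fastforce intro: less_imp_le)
        then show ?case using elim by (simp add: H_def)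
      qed
      then show "(\<lambda>k. H k y) \<longlonglongrightarrow> 0" by (rule tendsto_eventually)
    qed
    show "\<And>k. AE y in \<nu>. norm (H k y) \<le> G y" using Hle by auto
  qed auto
  then have "\<forall>\<^sub>F k in sequentially. (\<integral>y. H k y \<partial>\<nu>) < e"
    using e by (auto dest!: order_tendstoD(2))
  then obtain k where k: "(\<integral>y. H k y \<partial>\<nu>) < e"
    by (auto simp: eventually_sequentially)
  define r where "r = 1 / real (Suc k)"
  have r: "r > 0" by (simp add: r_def)
  \<comment> \<open>The first summand pays for \<open>G y \<le> k\<close> as soon as
  \<open>dist x y \<ge> r\<close>, since then \<open>C (dist x y) / C r \<ge> 1\<close>.\<close>
  define L where "L = k / C r + K"
  have L: "L \<ge> 0" using pos[OF r] K by (auto simp: L_def)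
  have key: "\<bar>f x - f y\<bar> \<le> e + H k y + L * C (dist x y)" for x y
  proof -
    have c0: "0 \<le> C (dist x y)" by (rule Cnn) simp
    have L': "L * C (dist x y) = k * (C (dist x y) / C r) + K * C (dist x y)"
      by (simp add: L_def algebra_simps)
    have q0: "0 \<le> k * (C (dist x y) / C r)" using c0 pos[OF r] by simp
    show ?thesis
    proof (cases "y \<in> U k \<and> G y \<le> real k")
      case False
      then show ?thesis using bound[of x y] q0 e L' by (auto simp: H_def)
    next
      case True
      show ?thesis
      proof (cases "dist x y < r")
        case True
        then have "\<bar>f x - f y\<bar> \<le> e" using \<open>y \<in> U k \<and> _\<close> by (auto simp: U_def r_def)
        then show ?thesis using Hle(1)[of k y] mult_nonneg_nonneg[OF L c0] by linarith
      next
        case False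
        then have "C r \<le> C (dist x y)" using r mono by (auto simp: mono_on_def)
        then have "1 \<le> C (dist x y) / C r" using pos[OF r] by simp
        then have "real k * 1 \<le> k * (C (dist x y) / C r)" by (intro mult_left_mono) auto
        then show ?thesis using bound[of x y] True L' Hle(1)[of k y] e by linarith
      qed
    qed
  qed
  \<comment> \<open>The \<open>+ 1\<close> covers the case \<open>L = 0\<close>.\<close>
  have "0 < ennreal (e / (L + 1))" using e L by simp
  then have "\<forall>\<^sub>F n in sequentially.
      transport_dist (\<lambda>x y. C (dist x y)) (\<mu> n) \<nu> < ennreal (e / (L + 1))"
    by (rule order_tendstoD(2)[OF T])
  moreover have "\<forall>\<^sub>F n in sequentially. n \<ge> (1::nat)" by (rule eventually_ge_at_top)
  ultimately show "\<forall>\<^sub>F n in sequentially. dist (\<integral>x. f x \<partial>\<mu> n) (\<integral>x. f x \<partial>\<nu>) < e'"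
  proof eventually_elim
    case (elim n)
    then obtain \<pi> where \<pi>: "\<pi> \<in> couplings (\<mu> n) \<nu>"
      and le: "(\<integral>\<^sup>+p. ennreal (C (dist (fst p) (snd p))) \<partial>\<pi>) < ennreal (e / (L + 1))"
      by (auto simp: transport_dist_def INF_less_iff)
    interpret \<pi>: prob_space \<pi> using \<pi> by (simp add: couplings_def)
    have s: "sets \<pi> = sets borel" using \<pi> by (simp add: couplings_def)
    have cm: "(\<lambda>p. C (dist (fst p) (snd p))) \<in> borel_measurable \<pi>"
      unfolding measurable_cong_sets[OF s refl]
      by (intro borel_measurable_continuous_onI continuous_on_compose_half_line[OF cont] continuous_intros) auto
    have ci: "integrable \<pi> (\<lambda>p. C (dist (fst p) (snd p)))"
      by (rule integrableI_nonneg[OF cm]) (use le Cnn in \<open>auto intro: order.strict_trans\<close>)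
    have "ennreal (\<integral>p. C (dist (fst p) (snd p)) \<partial>\<pi>) < ennreal (e / (L + 1))"
      using le by (subst nn_integral_eq_integral[symmetric, OF ci]) (auto simp: Cnn)
    then have cl: "(\<integral>p. C (dist (fst p) (snd p)) \<partial>\<pi>) < e / (L + 1)"
      by (subst (asm) ennreal_less_iff) (auto simp: Cnn)
    note fi = coupling_marginal_integral[OF \<pi> \<open>f \<in> borel_measurable borel\<close>]
    note Hi = coupling_marginal_integral[OF \<pi> Hm]
    note i = fi(3)[OF f\<mu>[OF elim(2)]] fi(4)[OF f\<nu>] Hi(4)[OF Hint] ci
    have "\<bar>(\<integral>x. f x \<partial>\<mu> n) - (\<integral>x. f x \<partial>\<nu>)\<bar> = \<bar>\<integral>p. f (fst p) - f (snd p) \<partial>\<pi>\<bar>"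
      using i fi(1,2) by simp
    also have "\<dots> \<le> (\<integral>p. \<bar>f (fst p) - f (snd p)\<bar> \<partial>\<pi>)"
      by (rule integral_abs_bound)
    also have "\<dots> \<le> (\<integral>p. e + H k (snd p) + L * C (dist (fst p) (snd p)) \<partial>\<pi>)"
      using i by (intro integral_mono) (auto simp: key)
    also have "\<dots> = e + (\<integral>y. H k y \<partial>\<nu>) + L * (\<integral>p. C (dist (fst p) (snd p)) \<partial>\<pi>)"
      using i Hi(2)[of k] by (simp add: \<pi>.prob_space)
    also have "\<dots> \<le> e + e + L * (e / (L + 1))"
      using k cl L by (intro add_mono mult_left_mono) auto
    also have "\<dots> \<le> 3 * e" using L e by (simp add: field_simps)
    finally show ?case using e by (simp add: dist_real_def)
  qed
qed

section \<open>Coupling two measures through their common mass\<close>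

text \<open>
  Fubini turns the two conditions on \<open>w\<close> into the two marginals. Second countability makes
  the product of the Borel \<open>\<sigma>\<close>-algebras the Borel \<open>\<sigma>\<close>-algebra of the product.
\<close>

lemma density_mem_couplings:
  fixes M N :: "'a::second_countable_topology measure"
  assumes M: "prob_space M" "sets M = sets borel" and N: "prob_space N" "sets N = sets borel"
    and w: "w \<in> borel_measurable (M \<Otimes>\<^sub>M N)"
    and w1: "AE x in M. (\<integral>\<^sup>+y. w (x, y) \<partial>N) = 1"
    and w2: "AE y in N. (\<integral>\<^sup>+x. w (x, y) \<partial>M) = 1"
  shows "density (M \<Otimes>\<^sub>M N) w \<in> couplings M N"
proof -
  interpret M: prob_space M by fact
  interpret N: prob_space N by fact
  interpret P: pair_sigma_finite M N ..
  note [measurable] = w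
  have sP: "sets (M \<Otimes>\<^sub>M N) = sets borel"
    using sets_pair_measure_cong[OF M(2) N(2)] by (metis borel_prod)
  have sp: "space M = UNIV" "space N = UNIV"
    using M(2) N(2) by (auto dest!: sets_eq_imp_space_eq)
  have fst: "fst \<in> measurable (density (M \<Otimes>\<^sub>M N) w) borel"
    and snd: "snd \<in> measurable (density (M \<Otimes>\<^sub>M N) w) borel"
    using measurable_cong_sets[OF refl M(2)] measurable_cong_sets[OF refl N(2)]
      measurable_fst[of M N] measurable_snd[of M N] by auto
  have d1: "distr (density (M \<Otimes>\<^sub>M N) w) borel fst = M"
  proof (rule measure_eqI)
    fix A assume "A \<in> sets (distr (density (M \<Otimes>\<^sub>M N) w) borel fst)"
    then have A: "A \<in> sets borel" by simp
    then have [measurable]: "A \<in> sets M" by (simp add: M)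
    have "emeasure (distr (density (M \<Otimes>\<^sub>M N) w) borel fst) A =
        emeasure (density (M \<Otimes>\<^sub>M N) w) (A \<times> space N)"
      using A sp by (subst emeasure_distr[OF fst]) (auto intro!: arg_cong[where f="emeasure _"] simp: space_pair_measure)
    also have "\<dots> = (\<integral>\<^sup>+p. w p * indicator (A \<times> space N) p \<partial>(M \<Otimes>\<^sub>M N))"
      by (subst emeasure_density) auto
    also have "\<dots> = (\<integral>\<^sup>+x. \<integral>\<^sup>+y. w (x, y) * indicator A x \<partial>N \<partial>M)"
      by (subst N.nn_integral_fst[symmetric])
        (auto intro!: nn_integral_cong split: split_indicator)
    also have "\<dots> = (\<integral>\<^sup>+x. (\<integral>\<^sup>+y. w (x, y) \<partial>N) * indicator A x \<partial>M)"
      by (intro nn_integral_cong nn_integral_multc) auto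
    also have "\<dots> = (\<integral>\<^sup>+x. indicator A x \<partial>M)"
      by (intro nn_integral_cong_AE) (use w1 in auto)
    finally show "emeasure (distr (density (M \<Otimes>\<^sub>M N) w) borel fst) A = emeasure M A"
      by simp
  qed (simp add: M)
  have d2: "distr (density (M \<Otimes>\<^sub>M N) w) borel snd = N"
  proof (rule measure_eqI)
    fix A assume "A \<in> sets (distr (density (M \<Otimes>\<^sub>M N) w) borel snd)"
    then have A: "A \<in> sets borel" by simp
    then have [measurable]: "A \<in> sets N" by (simp add: N)
    have "emeasure (distr (density (M \<Otimes>\<^sub>M N) w) borel snd) A =
        emeasure (density (M \<Otimes>\<^sub>M N) w) (space M \<times> A)"
      using A sp by (subst emeasure_distr[OF snd]) (auto intro!: arg_cong[where f="emeasure _"] simp: space_pair_measure)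
    also have "\<dots> = (\<integral>\<^sup>+p. w p * indicator (space M \<times> A) p \<partial>(M \<Otimes>\<^sub>M N))"
      by (subst emeasure_density) auto
    also have "\<dots> = (\<integral>\<^sup>+y. \<integral>\<^sup>+x. w (x, y) * indicator A y \<partial>M \<partial>N)"
      by (subst P.nn_integral_snd[symmetric])
        (auto intro!: nn_integral_cong split: split_indicator)
    also have "\<dots> = (\<integral>\<^sup>+y. (\<integral>\<^sup>+x. w (x, y) \<partial>M) * indicator A y \<partial>N)"
      by (intro nn_integral_cong nn_integral_multc) auto
    also have "\<dots> = (\<integral>\<^sup>+y. indicator A y \<partial>N)"
      by (intro nn_integral_cong_AE) (use w2 in auto)
    finally show "emeasure (distr (density (M \<Otimes>\<^sub>M N) w) borel snd) A = emeasure N A"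
      by simp
  qed (simp add: N)
  have "prob_space (distr (density (M \<Otimes>\<^sub>M N) w) borel fst)" by (simp add: d1 M)
  then have "prob_space (density (M \<Otimes>\<^sub>M N) w)"
    by (rule prob_space_distrD[OF fst])
  then show ?thesis by (simp add: couplings_def d1 d2 sP)
qed

text \<open>
  Tent functions \<open>\<phi> i\<close> around a dense sequence are made into a partition of unity by giving to
  \<open>f i\<close> the share \<open>\<phi> i\<close> of what \<open>f 0, \<dots>, f (i - 1)\<close> have left over. The leftover is then a
  product, and it vanishes as soon as one of the \<open>\<phi> j\<close> equals 1.
\<close>

lemma partition_of_unity_small_supports:
  fixes \<delta> :: real
  assumes "\<delta> > 0"
  obtains f :: "nat \<Rightarrow> 'a::{metric_space, second_countable_topology} \<Rightarrow> real"
  where "\<And>i. continuous_on UNIV (f i)" "\<And>i x. f i x \<ge> 0"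
    "\<And>k x. (\<Sum>i<k. f i x) \<le> 1"
    "\<And>i x y. f i x > 0 \<Longrightarrow> f i y > 0 \<Longrightarrow> dist x y \<le> \<delta>"
    "\<And>x. (\<lambda>k. \<Sum>i<k. f i x) \<longlonglongrightarrow> 1"
proof -
  obtain D :: "'a set" where D: "countable D" "\<And>X. open X \<Longrightarrow> X \<noteq> {} \<Longrightarrow> \<exists>d\<in>D. d \<in> X"
    by (rule countable_dense_setE) blast
  have ne: "D \<noteq> {}" using D(2)[of UNIV] by auto
  define z where "z = from_nat_into D"
  \<comment> \<open>Equal to 1 within distance \<open>\<delta> / 4\<close> of \<open>z i\<close>, and to 0 from distance
  \<open>\<delta> / 2\<close> on; the plateau ensures that every point has some \<open>\<phi> j\<close> equal to 1.\<close>
  define \<phi> where "\<phi> i x = min 1 (max 0 (2 - 4 * dist x (z i) / \<delta>))" for i x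
  define f where "f i x = \<phi> i x * (\<Prod>j<i. 1 - \<phi> j x)" for i x
  have \<phi>01: "0 \<le> \<phi> i x" "\<phi> i x \<le> 1" for i x by (auto simp: \<phi>_def)
  have sum: "(\<Sum>i<k. f i x) = 1 - (\<Prod>j<k. 1 - \<phi> j x)" for x k
    by (induction k) (auto simp: f_def algebra_simps)
  have p0: "0 \<le> (\<Prod>j<k. 1 - \<phi> j x)" for x k by (intro prod_nonneg) (auto simp: \<phi>01)
  show ?thesis
  proof
    show "continuous_on UNIV (f i)" for i
      unfolding f_def \<phi>_def using assms by (intro continuous_intros) auto
    show "f i x \<ge> 0" for i x unfolding f_def by (intro mult_nonneg_nonneg p0 \<phi>01)
    show "(\<Sum>i<k. f i x) \<le> 1" for x k using p0[of x k] by (simp add: sum)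
    show "dist x y \<le> \<delta>" if "f i x > 0" "f i y > 0" for i x y
    proof -
      have "dist x (z i) < \<delta> / 2" if "f i x > 0" for x
      proof -
        have "\<phi> i x \<noteq> 0" using that by (auto simp: f_def)
        then show ?thesis using assms by (auto simp: \<phi>_def min_def max_def field_simps split: if_splits)
      qed
      from this[OF that(1)] this[OF that(2)] show ?thesis
        using dist_triangle2[of x y "z i"] by simp
    qed
    show "(\<lambda>k. \<Sum>i<k. f i x) \<longlonglongrightarrow> 1" for x
    proof -
      obtain d where "d \<in> D" "d \<in> ball x (\<delta> / 4)" using D(2)[of "ball x (\<delta> / 4)"] assms by auto
      moreover then obtain j where "z j = d" using from_nat_into_surj[OF D(1)] by (auto simp: z_def)
      ultimately have "\<phi> j x = 1" using assms by (auto simp: \<phi>_def field_simps)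
      then have "(\<Sum>i<k. f i x) = 1" if "k \<ge> Suc j" for k
        using that by (auto simp: sum)
      then show ?thesis
        by (intro tendsto_eventually) (auto simp: eventually_sequentially)
    qed
  qed
qed

text \<open>
  The bound comes from the coupling that lets the two measures share as much mass as possible in each \<open>f i\<close>.
  Inside \<open>f i\<close> it couples the densities \<open>\<alpha> i * f i\<close> of \<open>M\<close> and \<open>\<beta> i * f i\<close> of \<open>N\<close> independently,
  where \<open>\<alpha> i = v i / max (u i) (v i)\<close> and \<open>\<beta> i = u i / max (u i) (v i)\<close>, so that both have mass
  \<open>min (u i) (v i)\<close>. What remains are the densities \<open>h\<close> and \<open>k\<close>, of common mass \<open>m\<close>, and they are
  coupled independently as well. The two differences on the right are \<open>\<integral>g * h \<partial>M\<close> and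
  \<open>\<integral>g * k \<partial>N\<close>. Division by zero being zero covers the degenerate cases: if
  \<open>max (u i) (v i) = 0\<close> or \<open>m = 0\<close>, then the corresponding densities vanish almost everywhere.
\<close>

lemma transport_dist_le_overlap:
  fixes M N :: "'a::second_countable_topology measure" and f :: "'i \<Rightarrow> 'a \<Rightarrow> real"
  assumes M: "prob_space M" "sets M = sets borel" and N: "prob_space N" "sets N = sets borel"
    and I: "finite I"
    and fm: "\<And>i. i \<in> I \<Longrightarrow> f i \<in> borel_measurable borel"
    and f0: "\<And>i x. i \<in> I \<Longrightarrow> 0 \<le> f i x" and f1: "\<And>x. (\<Sum>i\<in>I. f i x) \<le> 1"
    and cm: "(\<lambda>p. c (fst p) (snd p)) \<in> borel_measurable borel"
    and g0: "\<And>x. 0 \<le> g x" and gM: "integrable M g" and gN: "integrable N g"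
    and cg: "\<And>x y. c x y \<le> g x + g y"
    and K: "0 \<le> K" and cK: "\<And>i x y. i \<in> I \<Longrightarrow> 0 < f i x \<Longrightarrow> 0 < f i y \<Longrightarrow> c x y \<le> K"
  defines "u \<equiv> \<lambda>i. \<integral>x. f i x \<partial>M" and "v \<equiv> \<lambda>i. \<integral>x. f i x \<partial>N"
  shows "transport_dist c M N \<le> ennreal (K
    + ((\<integral>x. g x \<partial>M) - (\<Sum>i\<in>I. v i / max (u i) (v i) * (\<integral>x. g x * f i x \<partial>M)))
    + ((\<integral>x. g x \<partial>N) - (\<Sum>i\<in>I. u i / max (u i) (v i) * (\<integral>x. g x * f i x \<partial>N))))"
proof -
  interpret M: prob_space M by fact
  interpret N: prob_space N by fact
  interpret P: pair_sigma_finite M N ..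
  have f_le_1: "f i x \<le> 1" if "i \<in> I" for i x
    using member_le_sum[of i I "\<lambda>i. f i x"] that f0 f1[of x] I by fastforce
  have fm'[measurable]: "f i \<in> borel_measurable M" "f i \<in> borel_measurable N" if "i \<in> I" for i
    using fm[OF that] measurable_cong_sets[OF M(2) refl] measurable_cong_sets[OF N(2) refl] by auto
  have gm[measurable]: "g \<in> borel_measurable M" "g \<in> borel_measurable N"
    using gM gN by auto
  have fM: "integrable M (f i)" and fN: "integrable N (f i)" if "i \<in> I" for i
    using that f0 f_le_1 by (auto intro!: M.integrable_const_bound[where B=1]
        N.integrable_const_bound[where B=1])
  have bnd: "\<bar>g x * f i x\<bar> \<le> \<bar>g x\<bar>" if "i \<in> I" for i x
    using mult_left_mono[OF f_le_1[OF that] g0, of x] g0[of x] f0[OF that, of x] by simp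
  have gfM: "integrable M (\<lambda>x. g x * f i x)" and gfN: "integrable N (\<lambda>x. g x * f i x)"
    if "i \<in> I" for i
    using that bnd by (auto intro!: Bochner_Integration.integrable_bound[OF gM]
        Bochner_Integration.integrable_bound[OF gN])
  define q where "q i = max (u i) (v i)" for i
  define \<alpha> where "\<alpha> i = v i / q i" for i
  define \<beta> where "\<beta> i = u i / q i" for i
  have u0: "0 \<le> u i" and v0: "0 \<le> v i" if "i \<in> I" for i
    using that f0 by (auto simp: u_def v_def)
  have q0: "0 \<le> q i" if "i \<in> I" for i using u0[OF that] by (simp add: q_def)
  have \<alpha>01: "0 \<le> \<alpha> i" "\<alpha> i \<le> 1" and \<beta>01: "0 \<le> \<beta> i" "\<beta> i \<le> 1" if "i \<in> I" for i
    using u0[OF that] v0[OF that] by (auto simp: \<alpha>_def \<beta>_def q_def max_def divide_le_eq)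
  define h where "h x = 1 - (\<Sum>i\<in>I. \<alpha> i * f i x)" for x
  define k where "k y = 1 - (\<Sum>i\<in>I. \<beta> i * f i y)" for y
  have sum_le: "(\<Sum>i\<in>I. a i * f i x) \<le> 1" if "\<And>i. i \<in> I \<Longrightarrow> a i \<le> 1" for a x
  proof -
    have "(\<Sum>i\<in>I. a i * f i x) \<le> (\<Sum>i\<in>I. 1 * f i x)"
      by (intro sum_mono mult_right_mono that f0)
    then show ?thesis using f1[of x] by simp
  qed
  have h0: "0 \<le> h x" and k0: "0 \<le> k x" for x
    using sum_le[of \<alpha> x] sum_le[of \<beta> x] \<alpha>01 \<beta>01 by (auto simp: h_def k_def)
  have hI: "integrable M h" and kI: "integrable N k"
    unfolding h_def k_def using fM fN by (auto intro!: Bochner_Integration.integrable_diff)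
  note [measurable] = borel_measurable_integrable[OF hI] borel_measurable_integrable[OF kI]
  define m where "m = (\<integral>x. h x \<partial>M)"
  have mM: "m = 1 - (\<Sum>i\<in>I. \<alpha> i * u i)"
    unfolding m_def h_def u_def using fM by (subst Bochner_Integration.integral_diff) (auto simp: M.prob_space)
  have mN: "(\<integral>y. k y \<partial>N) = m"
    unfolding mM k_def using fN
    by (subst Bochner_Integration.integral_diff)
      (auto simp: N.prob_space \<alpha>_def \<beta>_def v_def intro!: sum.cong)
  have m0: "0 \<le> m" unfolding m_def using h0 by simp
  have mh: "AE x in M. h x * (m / m) = h x"
    using integral_nonneg_eq_0_iff_AE[OF hI] h0 by (cases "m = 0") (auto simp: m_def)
  have mk: "AE y in N. k y * (m / m) = k y"
    using integral_nonneg_eq_0_iff_AE[OF kI] k0 mN by (cases "m = 0") auto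
  \<comment> \<open>The density of the coupling with respect to \<open>M \<Otimes>\<^sub>M N\<close>.\<close>
  define W where "W x y = (\<Sum>i\<in>I. f i x * f i y / q i) + h x * k y / m" for x y
  have W0: "0 \<le> W x y" for x y
    using f0 q0 h0 k0 m0
    by (auto simp: W_def intro!: add_nonneg_nonneg sum_nonneg divide_nonneg_nonneg mult_nonneg_nonneg)
  define w where "w p = ennreal (W (fst p) (snd p))" for p
  have w[measurable]: "w \<in> borel_measurable (M \<Otimes>\<^sub>M N)"
    unfolding w_def W_def by measurable
  have W1: "AE x in M. (\<integral>\<^sup>+y. w (x, y) \<partial>N) = 1"
    using mh
  proof eventually_elim
    case (elim x)
    have i: "integrable N (W x)"
      unfolding W_def using fN kI by (auto intro!: Bochner_Integration.integrable_add Bochner_Integration.integrable_sum)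
    have "(\<integral>y. W x y \<partial>N) = (\<Sum>i\<in>I. f i x * v i / q i) + h x * m / m"
      unfolding W_def v_def mN[symmetric] using fN kI by (subst Bochner_Integration.integral_add) auto
    also have "\<dots> = (\<Sum>i\<in>I. \<alpha> i * f i x) + h x * (m / m)"
      by (simp add: \<alpha>_def mult.commute)
    also have "\<dots> = 1" unfolding elim by (simp add: h_def)
    finally show ?case
      by (simp add: w_def nn_integral_eq_integral[OF i] W0)
  qed
  have W2: "AE y in N. (\<integral>\<^sup>+x. w (x, y) \<partial>M) = 1"
    using mk
  proof eventually_elim
    case (elim y)
    have i: "integrable M (\<lambda>x. W x y)"
      unfolding W_def using fM hI by (auto intro!: Bochner_Integration.integrable_add Bochner_Integration.integrable_sum)
    have "(\<integral>x. W x y \<partial>M) = (\<Sum>i\<in>I. u i * f i y / q i) + m * k y / m"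
      unfolding W_def u_def m_def using fM hI by (subst Bochner_Integration.integral_add) auto
    also have "\<dots> = (\<Sum>i\<in>I. \<beta> i * f i y) + k y * (m / m)"
      by (simp add: \<beta>_def mult.commute)
    also have "\<dots> = 1" unfolding elim by (simp add: k_def)
    finally show ?case
      by (simp add: w_def nn_integral_eq_integral[OF i] W0)
  qed
  have \<pi>: "density (M \<Otimes>\<^sub>M N) w \<in> couplings M N"
    by (rule density_mem_couplings[OF M N w W1 W2])
  have sP: "sets (M \<Otimes>\<^sub>M N) = sets borel"
    using sets_pair_measure_cong[OF M(2) N(2)] by (metis borel_prod)
  have cm'[measurable]: "(\<lambda>p. c (fst p) (snd p)) \<in> borel_measurable (M \<Otimes>\<^sub>M N)"
    using cm measurable_cong_sets[OF sP refl] by auto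
  \<comment> \<open>Each summand of \<open>W\<close> with index in \<open>I\<close> meets a cost of at most \<open>K\<close>, the last one
  a cost of at most \<open>g x + g y\<close>.\<close>
  have point: "W x y * c x y \<le> K * W x y + g x * h x * (k y / m) + g y * k y * (h x / m)" for x y
  proof -
    have "f i x * f i y / q i * c x y \<le> f i x * f i y / q i * K" if "i \<in> I" for i
    proof (cases "0 < f i x \<and> 0 < f i y")
      case True
      then show ?thesis using cK[OF that] q0[OF that] by (intro mult_left_mono) auto
    next
      case False
      then have "f i x * f i y = 0" using f0[OF that, of x] f0[OF that, of y] by auto
      then show ?thesis by (simp only: div_0 mult_zero_left order_refl)
    qed
    then have "(\<Sum>i\<in>I. f i x * f i y / q i) * c x y \<le> (\<Sum>i\<in>I. f i x * f i y / q i) * K"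
      unfolding sum_distrib_right by (rule sum_mono)
    moreover
    have hk: "0 \<le> h x * k y / m" using h0 k0 m0 by simp
    then have "h x * k y / m * c x y \<le> h x * k y / m * (g x + g y)"
      by (intro mult_left_mono cg)
    moreover have "0 \<le> h x * k y / m * K" by (rule mult_nonneg_nonneg[OF hk K])
    ultimately show ?thesis by (simp add: W_def algebra_simps add_divide_distrib)
  qed
  have gh: "integrable M (\<lambda>x. g x * h x)" "(\<integral>x. g x * h x \<partial>M) =
      (\<integral>x. g x \<partial>M) - (\<Sum>i\<in>I. v i / max (u i) (v i) * (\<integral>x. g x * f i x \<partial>M))"
    using gM gfM unfolding h_def right_diff_distrib sum_distrib_left mult.left_commute[of "g _"]
    by (simp_all add: \<alpha>_def q_def)
  have gk: "integrable N (\<lambda>x. g x * k x)" "(\<integral>x. g x * k x \<partial>N) =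
      (\<integral>x. g x \<partial>N) - (\<Sum>i\<in>I. u i / max (u i) (v i) * (\<integral>x. g x * f i x \<partial>N))"
    using gN gfN unfolding k_def right_diff_distrib sum_distrib_left mult.left_commute[of "g _"]
    by (simp_all add: \<beta>_def q_def)
  have mm: "m / m \<le> 1" by simp
  have t1: "(\<integral>\<^sup>+p. w p \<partial>(M \<Otimes>\<^sub>M N)) = 1"
    by (subst N.nn_integral_fst[symmetric]) (auto simp: nn_integral_cong_AE[OF W1] M.emeasure_space_1)
  have t2: "(\<integral>\<^sup>+p. ennreal (g (fst p) * h (fst p) * (k (snd p) / m)) \<partial>(M \<Otimes>\<^sub>M N))
      \<le> ennreal (\<integral>x. g x * h x \<partial>M)"
  proof -
    have "(\<integral>\<^sup>+p. ennreal (g (fst p) * h (fst p) * (k (snd p) / m)) \<partial>(M \<Otimes>\<^sub>M N))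
      = (\<integral>\<^sup>+x. \<integral>\<^sup>+y. ennreal (g x * h x * (k y / m)) \<partial>N \<partial>M)"
      by (subst N.nn_integral_fst[symmetric]) auto
    also have "\<dots> = (\<integral>\<^sup>+x. ennreal (g x * h x * (m / m)) \<partial>M)"
      by (intro nn_integral_cong, subst nn_integral_eq_integral)
        (use kI g0 h0 k0 m0 mN in \<open>auto\<close>)
    also have "\<dots> \<le> (\<integral>\<^sup>+x. ennreal (g x * h x) \<partial>M)"
      using mm g0 h0 by (intro nn_integral_mono ennreal_leI mult_left_le mm) auto
    also have "\<dots> = ennreal (\<integral>x. g x * h x \<partial>M)"
      by (rule nn_integral_eq_integral[OF gh(1)]) (use g0 h0 in auto)
    finally show ?thesis .
  qed
  have t3: "(\<integral>\<^sup>+p. ennreal (g (snd p) * k (snd p) * (h (fst p) / m)) \<partial>(M \<Otimes>\<^sub>M N))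
      \<le> ennreal (\<integral>x. g x * k x \<partial>N)"
  proof -
    have "(\<integral>\<^sup>+p. ennreal (g (snd p) * k (snd p) * (h (fst p) / m)) \<partial>(M \<Otimes>\<^sub>M N))
      = (\<integral>\<^sup>+y. \<integral>\<^sup>+x. ennreal (g y * k y * (h x / m)) \<partial>M \<partial>N)"
      by (subst P.nn_integral_snd[symmetric]) auto
    also have "\<dots> = (\<integral>\<^sup>+y. ennreal (g y * k y * (m / m)) \<partial>N)"
      by (intro nn_integral_cong, subst nn_integral_eq_integral)
        (use hI g0 h0 k0 m0 in \<open>auto simp: m_def\<close>)
    also have "\<dots> \<le> (\<integral>\<^sup>+x. ennreal (g x * k x) \<partial>N)"
      using mm g0 k0 by (intro nn_integral_mono ennreal_leI mult_left_le mm) auto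
    also have "\<dots> = ennreal (\<integral>x. g x * k x \<partial>N)"
      by (rule nn_integral_eq_integral[OF gk(1)]) (use g0 k0 in auto)
    finally show ?thesis .
  qed
  have "transport_dist c M N \<le> (\<integral>\<^sup>+p. ennreal (c (fst p) (snd p)) \<partial>density (M \<Otimes>\<^sub>M N) w)"
    unfolding transport_dist_def by (rule INF_lower[OF \<pi>])
  also have "\<dots> = (\<integral>\<^sup>+p. ennreal (W (fst p) (snd p) * c (fst p) (snd p)) \<partial>(M \<Otimes>\<^sub>M N))"
    by (subst nn_integral_density) (auto simp: w_def ennreal_mult' W0)
  also have "\<dots> \<le> (\<integral>\<^sup>+p. ennreal K * w p + ennreal (g (fst p) * h (fst p) * (k (snd p) / m))
      + ennreal (g (snd p) * k (snd p) * (h (fst p) / m)) \<partial>(M \<Otimes>\<^sub>M N))"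
  proof (rule nn_integral_mono)
    fix p
    have "ennreal K * w p + ennreal (g (fst p) * h (fst p) * (k (snd p) / m))
      + ennreal (g (snd p) * k (snd p) * (h (fst p) / m)) =
      ennreal (K * W (fst p) (snd p) + g (fst p) * h (fst p) * (k (snd p) / m)
        + g (snd p) * k (snd p) * (h (fst p) / m))"
      using K W0 g0 h0 k0 m0 by (simp add: w_def ennreal_mult' ennreal_plus)
    then show "ennreal (W (fst p) (snd p) * c (fst p) (snd p)) \<le> ennreal K * w p
        + ennreal (g (fst p) * h (fst p) * (k (snd p) / m))
        + ennreal (g (snd p) * k (snd p) * (h (fst p) / m))"
      using point by (simp add: ennreal_leI)
  qed
  also have "\<dots> = ennreal K * (\<integral>\<^sup>+p. w p \<partial>(M \<Otimes>\<^sub>M N))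
      + (\<integral>\<^sup>+p. ennreal (g (fst p) * h (fst p) * (k (snd p) / m)) \<partial>(M \<Otimes>\<^sub>M N))
      + (\<integral>\<^sup>+p. ennreal (g (snd p) * k (snd p) * (h (fst p) / m)) \<partial>(M \<Otimes>\<^sub>M N))"
    by (simp add: nn_integral_add nn_integral_cmult)
  also have "\<dots> \<le> ennreal K + ennreal (\<integral>x. g x * h x \<partial>M) + ennreal (\<integral>x. g x * k x \<partial>N)"
    using t2 t3 by (intro add_mono) (auto simp: t1)
  also have "\<dots> = ennreal (K + (\<integral>x. g x * h x \<partial>M) + (\<integral>x. g x * k x \<partial>N))"
    using K g0 h0 k0 by (simp add: ennreal_plus)
  finally show ?thesis unfolding gh(2) gk(2) .
qed

text \<open>
  The functions \<open>f i\<close> being fixed, the bound of \<open>transport_dist_le_overlap\<close> involves \<open>\<mu> n\<close>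
  only through integrals of bounded continuous functions, and through the moment that
  is assumed to converge. The part of the moment that lies in the leftover is controlled because
  it is the whole moment minus the moments inside the supports of the \<open>f i\<close>.
\<close>

lemma transport_dist_tendsto_0:
  fixes \<mu> :: "nat \<Rightarrow> 'a::{metric_space, second_countable_topology} measure"
  assumes \<mu>: "\<And>n. n \<ge> 1 \<Longrightarrow> prob_space (\<mu> n)" "\<And>n. n \<ge> 1 \<Longrightarrow> sets (\<mu> n) = sets borel"
    and \<nu>: "prob_space \<nu>" "sets \<nu> = sets borel"
    and nonneg: "\<And>t. t \<ge> 0 \<Longrightarrow> C t \<ge> 0" and mono: "mono_on {0..} C"
    and cont: "continuous_on {0..} C" and C0: "C 0 = 0"
    and g\<mu>: "\<And>n. n \<ge> 1 \<Longrightarrow> integrable (\<mu> n) (\<lambda>x. C (2 * dist x a))"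
    and g\<nu>: "integrable \<nu> (\<lambda>x. C (2 * dist x a))"
    and weak: "converges_weakly \<mu> \<nu>"
    and mom: "(\<lambda>n. \<integral>x. C (2 * dist x a) \<partial>\<mu> n) \<longlonglongrightarrow> (\<integral>x. C (2 * dist x a) \<partial>\<nu>)"
  shows "(\<lambda>n. transport_dist (\<lambda>x y. C (dist x y)) (\<mu> n) \<nu>) \<longlonglongrightarrow> 0"
proof (rule order_tendstoI)
  fix e :: ennreal assume "0 < e"
  then obtain r' where r': "0 < r'" "r' < e" using dense by blast
  then obtain r where r: "r' = ennreal r" "r > 0"
    by (cases r') (auto simp: top_unique)
  have Cle: "C s \<le> C t" if "0 \<le> s" "s \<le> t" for s t
    using mono that by (auto simp: mono_on_def)
  define g where "g = (\<lambda>x. C (2 * dist x a))"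
  have g0: "0 \<le> g x" for x by (simp add: g_def nonneg)
  have gc: "continuous_on UNIV g"
    unfolding g_def by (intro continuous_on_compose_half_line[OF cont] continuous_intros) auto
  have "(C \<longlongrightarrow> 0) (at 0 within {0..})"
    using cont C0 by (force simp: continuous_on_def)
  then have "\<forall>\<^sub>F t in at 0 within {0..}. C t < r / 4"
    by (rule order_tendstoD(2)) (use r in simp)
  then obtain d where d: "d > 0" "\<And>t. t \<ge> 0 \<Longrightarrow> t \<noteq> 0 \<Longrightarrow> dist t 0 < d \<Longrightarrow> C t < r / 4"
    by (auto simp: eventually_at)
  define \<delta> where "\<delta> = d / 2"
  have \<delta>: "\<delta> > 0" "C \<delta> < r / 4" using d by (auto simp: \<delta>_def)
  obtain f :: "nat \<Rightarrow> 'a \<Rightarrow> real" where fc: "\<And>i. continuous_on UNIV (f i)"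
    and f0: "\<And>i x. f i x \<ge> 0" and f1: "\<And>k x. (\<Sum>i<k. f i x) \<le> 1"
    and fd: "\<And>i x y. f i x > 0 \<Longrightarrow> f i y > 0 \<Longrightarrow> dist x y \<le> \<delta>"
    and flim: "\<And>x. (\<lambda>k. \<Sum>i<k. f i x) \<longlonglongrightarrow> 1"
    using partition_of_unity_small_supports[OF \<delta>(1)] by metis
  have f_le_1: "f i x \<le> 1" for i x
    using member_le_sum[of i "{..<Suc i}" "\<lambda>i. f i x"] f0 f1[of x "Suc i"] by force
  have fb: "\<bar>f i x\<bar> \<le> 1" for i x using f0 f_le_1 by auto
  have gfc: "continuous_on UNIV (\<lambda>x. g x * f i x)" for i
    by (intro continuous_intros gc fc)
  \<comment> \<open>The support of \<open>f i\<close> is bounded, and \<open>g\<close> is bounded on bounded sets.\<close>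
  have gfb: "\<exists>B. \<forall>x. \<bar>g x * f i x\<bar> \<le> B" for i
  proof (cases "\<exists>x. f i x > 0")
    case True
    then obtain z where z: "f i z > 0" by auto
    have "\<bar>g x * f i x\<bar> \<le> C (2 * (\<delta> + dist z a))" for x
    proof (cases "f i x > 0")
      case True
      have "dist x a \<le> \<delta> + dist z a" using dist_triangle[of x a z] fd[OF True z] by simp
      then have "g x \<le> C (2 * (\<delta> + dist z a))" unfolding g_def by (intro Cle) auto
      moreover have "g x * f i x \<le> g x" using f_le_1 g0 by (simp add: mult_left_le)
      ultimately show ?thesis using g0[of x] f0[of i x] by simp
    next
      case False
      then have "f i x = 0" using f0[of i x] by simp
      then show ?thesis using \<delta> by (simp add: nonneg)
    qed
    then show ?thesis by blast
  next
    case False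
    then have "f i x = 0" for x using f0[of i x] by (metis less_le)
    then show ?thesis by auto
  qed
  have weakD: "(\<lambda>n. \<integral>x. F x \<partial>\<mu> n) \<longlonglongrightarrow> (\<integral>x. F x \<partial>\<nu>)"
    if "continuous_on UNIV F" "\<And>x. \<bar>F x\<bar> \<le> B" for F :: "'a \<Rightarrow> real" and B
    using weak that by (auto simp: converges_weakly_def bounded_iff)
  have gf\<nu>: "integrable \<nu> (\<lambda>x. g x * f i x)" for i
    using integrable_if_bounded_continuous[OF \<nu> gfc] gfb by blast
  have gfl: "(\<lambda>n. \<integral>x. g x * f i x \<partial>\<mu> n) \<longlonglongrightarrow> (\<integral>x. g x * f i x \<partial>\<nu>)" for i
    using weakD[OF gfc] gfb by blast
  define u where "u n i = (\<integral>x. f i x \<partial>\<mu> n)" for n i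
  define v where "v i = (\<integral>x. f i x \<partial>\<nu>)" for i
  have ul: "(\<lambda>n. u n i) \<longlonglongrightarrow> v i" for i
    unfolding u_def v_def by (rule weakD[OF fc fb])
  have v0: "0 \<le> v i" for i unfolding v_def using f0 by simp
  have "(\<lambda>k. \<integral>x. g x * (1 - (\<Sum>i<k. f i x)) \<partial>\<nu>) \<longlonglongrightarrow> (\<integral>x. 0 \<partial>\<nu>)"
  proof (rule integral_dominated_convergence[where w=g])
    show "integrable \<nu> g" using g\<nu> by (simp add: g_def)
    show "(\<lambda>x. g x * (1 - (\<Sum>i<k. f i x))) \<in> borel_measurable \<nu>" for k
      unfolding measurable_cong_sets[OF \<nu>(2) refl]
      by (intro borel_measurable_continuous_onI continuous_intros gc fc)
    show "AE x in \<nu>. (\<lambda>k. g x * (1 - (\<Sum>i<k. f i x))) \<longlonglongrightarrow> 0"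
      by (rule AE_I2) (auto intro!: tendsto_eq_intros flim)
    show "AE x in \<nu>. norm (g x * (1 - (\<Sum>i<k. f i x))) \<le> g x" for k
    proof (rule AE_I2)
      fix x
      have "0 \<le> 1 - (\<Sum>i<k. f i x)" "1 - (\<Sum>i<k. f i x) \<le> 1"
        using f1[of x k] f0 by (auto intro: sum_nonneg)
      then show "norm (g x * (1 - (\<Sum>i<k. f i x))) \<le> g x"
        using g0[of x] by (auto simp: abs_mult mult_left_le)
    qed
  qed simp
  then have "\<forall>\<^sub>F k in sequentially. (\<integral>x. g x * (1 - (\<Sum>i<k. f i x)) \<partial>\<nu>) < r / 4"
    by (rule order_tendstoD(2)) (use r in simp)
  then obtain k where k: "(\<integral>x. g x * (1 - (\<Sum>i<k. f i x)) \<partial>\<nu>) < r / 4"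
    by (auto simp: eventually_sequentially)
  have "(\<integral>x. g x * (1 - (\<Sum>i<k. f i x)) \<partial>\<nu>) = (\<integral>x. g x \<partial>\<nu>) - (\<Sum>i<k. \<integral>x. g x * f i x \<partial>\<nu>)"
    using g\<nu> gf\<nu> by (simp add: right_diff_distrib sum_distrib_left g_def)
  with k have k': "(\<integral>x. g x \<partial>\<nu>) - (\<Sum>i<k. \<integral>x. g x * f i x \<partial>\<nu>) < r / 4" by simp
  have v_0_D: "(\<integral>x. g x * f i x \<partial>\<nu>) = 0" if "v i = 0" for i
  proof -
    have "integrable \<nu> (f i)" by (rule integrable_if_bounded_continuous[OF \<nu> fc fb])
    then have "AE x in \<nu>. f i x = 0"
      using that f0 integral_nonneg_eq_0_iff_AE[of \<nu> "f i"] by (auto simp: v_def)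
    then show ?thesis by (intro integral_eq_zero_AE) auto
  qed
  \<comment> \<open>The coefficient tends to 1 if \<open>v i > 0\<close>. If \<open>v i = 0\<close> it need not, but then the limit of
  the integrals is 0.\<close>
  have l1: "(\<lambda>n. v i / max (u n i) (v i) * (\<integral>x. g x * f i x \<partial>\<mu> n)) \<longlonglongrightarrow> (\<integral>x. g x * f i x \<partial>\<nu>)" for i
  proof (cases "v i = 0")
    case True
    then show ?thesis by (simp add: v_0_D)
  next
    case False
    then show ?thesis by (auto intro!: tendsto_eq_intros ul gfl)
  qed
  have l2: "(\<lambda>n. u n i / max (u n i) (v i) * (\<integral>x. g x * f i x \<partial>\<nu>)) \<longlonglongrightarrow> (\<integral>x. g x * f i x \<partial>\<nu>)" for i
  proof (cases "v i = 0")
    case True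
    then show ?thesis by (simp add: v_0_D)
  next
    case False
    then show ?thesis by (auto intro!: tendsto_eq_intros ul)
  qed
  define E where "E n = C \<delta>
    + ((\<integral>x. g x \<partial>\<mu> n) - (\<Sum>i<k. v i / max (u n i) (v i) * (\<integral>x. g x * f i x \<partial>\<mu> n)))
    + ((\<integral>x. g x \<partial>\<nu>) - (\<Sum>i<k. u n i / max (u n i) (v i) * (\<integral>x. g x * f i x \<partial>\<nu>)))" for n
  have "E \<longlonglongrightarrow> C \<delta> + ((\<integral>x. g x \<partial>\<nu>) - (\<Sum>i<k. \<integral>x. g x * f i x \<partial>\<nu>))
    + ((\<integral>x. g x \<partial>\<nu>) - (\<Sum>i<k. \<integral>x. g x * f i x \<partial>\<nu>))"
    unfolding E_def using mom by (intro tendsto_intros l1 l2) (simp add: g_def)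
  moreover have "C \<delta> + ((\<integral>x. g x \<partial>\<nu>) - (\<Sum>i<k. \<integral>x. g x * f i x \<partial>\<nu>))
    + ((\<integral>x. g x \<partial>\<nu>) - (\<Sum>i<k. \<integral>x. g x * f i x \<partial>\<nu>)) < r" using k' \<delta>(2) r(2) by linarith
  ultimately have "\<forall>\<^sub>F n in sequentially. E n < r" by (rule order_tendstoD(2))
  moreover have "\<forall>\<^sub>F n in sequentially. n \<ge> (1::nat)" by (rule eventually_ge_at_top)
  ultimately show "\<forall>\<^sub>F n in sequentially. transport_dist (\<lambda>x y. C (dist x y)) (\<mu> n) \<nu> < e"
  proof eventually_elim
    case (elim n)
    have "transport_dist (\<lambda>x y. C (dist x y)) (\<mu> n) \<nu> \<le> ennreal (E n)"
      unfolding E_def u_def v_def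
    proof (rule transport_dist_le_overlap[OF \<mu>(1)[OF elim(2)] \<mu>(2)[OF elim(2)] \<nu>])
      show "(\<lambda>p. C (dist (fst p) (snd p))) \<in> borel_measurable borel"
        by (intro borel_measurable_continuous_onI continuous_on_compose_half_line[OF cont] continuous_intros) auto
      show "f i \<in> borel_measurable borel" for i by (rule borel_measurable_continuous_onI[OF fc])
      show "integrable (\<mu> n) g" "integrable \<nu> g" using g\<mu>[OF elim(2)] g\<nu> by (simp_all add: g_def)
      show "C (dist x y) \<le> g x + g y" for x y
      proof -
        have "dist x y \<le> 2 * dist x a \<or> dist x y \<le> 2 * dist y a"
          using dist_triangle2[of x y a] by linarith
        then have "C (dist x y) \<le> g x \<or> C (dist x y) \<le> g y"
          unfolding g_def by (auto intro: Cle)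
        then show ?thesis using g0[of x] g0[of y] by auto
      qed
      show "C (dist x y) \<le> C \<delta>" if "0 < f i x" "0 < f i y" for i x y
        using fd[OF that] by (intro Cle) auto
      show "0 \<le> C \<delta>" using \<delta> by (simp add: nonneg)
    qed (auto simp: f0 f1 g0)
    also have "\<dots> < ennreal r" using elim(1) r(2) by (simp add: ennreal_lessI)
    finally show ?case using r'(2) r(1) by simp
  qed
qed simp

section \<open>Consequences of the doubling condition\<close>

text \<open>
  A zero of \<open>C\<close> at a positive \<open>t\<close> would spread to all \<open>2 ^ k * t\<close>, hence by monotonicity everywhere.
\<close>

lemma doubling_pos:
  assumes dbl: "doubling C" and mono: "mono_on {0..} C"
    and nonneg: "\<And>t. t \<ge> 0 \<Longrightarrow> C t \<ge> 0" and s: "s \<ge> 0" "C s \<noteq> 0" and t: "t > 0"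
  shows "C t > 0"
proof (rule ccontr)
  assume "\<not> 0 < C t"
  then have Ct: "C t = 0" using nonneg[of t] t by simp
  obtain l where l: "l > 0" "\<And>y. y \<ge> 0 \<Longrightarrow> C (2 * y) \<le> l * C y"
    using dbl by (auto simp: doubling_def)
  have z: "C (2 ^ k * t) = 0" for k
  proof (induction k)
    case (Suc k)
    have "C (2 * (2 ^ k * t)) \<le> l * C (2 ^ k * t)" using t by (intro l(2)) simp
    then show ?case using Suc nonneg[of "2 * (2 ^ k * t)"] t by (simp add: mult.assoc)
  qed (simp add: Ct)
  obtain k where "s / t < 2 ^ k" using real_arch_pow[of 2 "s / t"] by auto
  then have "s \<le> 2 ^ k * t" using t by (simp add: field_simps)
  then have "C s \<le> C (2 ^ k * t)" using mono s t by (auto simp: mono_on_def)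
  then show False using z nonneg[OF s(1)] s(2) by (metis antisym)
qed

text \<open>
  Because \<open>dist x b\<close> is at most twice the larger of \<open>dist a b\<close> and \<open>dist x a\<close>, one doubling
  bounds the integrand for \<open>b\<close> by a constant plus a multiple of the integrand for \<open>a\<close>.
\<close>

lemma double_moment_finite_change_base:
  fixes M :: "'a::metric_space measure"
  assumes M: "prob_space M" "sets M = sets borel" and dbl: "doubling C" and mono: "mono_on {0..} C"
    and cont: "continuous_on {0..} C" and nonneg: "\<And>t. t \<ge> 0 \<Longrightarrow> C t \<ge> 0"
    and fin: "double_moment C a M < \<infinity>"
  shows "double_moment C b M < \<infinity>"
proof -
  interpret prob_space M by fact
  obtain l where l: "l > 0" "\<And>y. y \<ge> 0 \<Longrightarrow> C (2 * y) \<le> l * C y"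
    using dbl by (auto simp: doubling_def)
  have Cle: "C s \<le> C t" if "0 \<le> s" "s \<le> t" for s t
    using mono that by (auto simp: mono_on_def)
  have le: "C (2 * dist x b) \<le> l * C (2 * dist a b) + l * C (2 * dist x a)" for x
  proof -
    have "dist x b \<le> 2 * dist a b \<or> dist x b \<le> 2 * dist x a"
      using dist_triangle[of x b a] by linarith
    then have "C (2 * dist x b) \<le> C (2 * (2 * dist a b)) \<or> C (2 * dist x b) \<le> C (2 * (2 * dist x a))"
      by (auto intro: Cle)
    then have "C (2 * dist x b) \<le> l * C (2 * dist a b) \<or> C (2 * dist x b) \<le> l * C (2 * dist x a)"
      using l(2)[of "2 * dist a b"] l(2)[of "2 * dist x a"] by auto
    moreover have "0 \<le> l * C (2 * dist a b)" "0 \<le> l * C (2 * dist x a)" using l nonneg by auto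
    ultimately show ?thesis by auto
  qed
  have m: "(\<lambda>x. C (2 * dist x a)) \<in> borel_measurable M"
    unfolding measurable_cong_sets[OF M(2) refl]
    by (intro borel_measurable_continuous_onI continuous_on_compose_half_line[OF cont] continuous_intros) auto
  have "double_moment C b M \<le>
      (\<integral>\<^sup>+x. ennreal (l * C (2 * dist a b)) + ennreal l * ennreal (C (2 * dist x a)) \<partial>M)"
    unfolding double_moment_def
  proof (rule nn_integral_mono)
    fix x
    have "ennreal (l * C (2 * dist a b)) + ennreal l * ennreal (C (2 * dist x a)) =
        ennreal (l * C (2 * dist a b) + l * C (2 * dist x a))"
      using l nonneg by (simp add: ennreal_mult' ennreal_plus)
    then show "ennreal (C (2 * dist x b)) \<le>
        ennreal (l * C (2 * dist a b)) + ennreal l * ennreal (C (2 * dist x a))"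
      using le by (simp add: ennreal_leI)
  qed
  also have "\<dots> = ennreal (l * C (2 * dist a b)) + ennreal l * double_moment C a M"
    using m unfolding double_moment_def
    by (subst nn_integral_add) (auto simp: nn_integral_cmult emeasure_space_1)
  also have "\<dots> < \<infinity>" using fin by (simp add: ennreal_mult_less_top)
  finally show ?thesis .
qed

section \<open>Transportation distance, weak convergence and moments\<close>

theorem theorem2:
  fixes \<mu> :: "nat \<Rightarrow> 'a::polish_space measure"
    and \<nu> :: "'a measure"
    and c :: "'a \<Rightarrow> 'a \<Rightarrow> real"
    and C :: "real \<Rightarrow> real"
    and a :: 'a
  assumes "\<And>n. n \<ge> 1 \<Longrightarrow> prob_space (\<mu> n)"
    and "\<And>n. n \<ge> 1 \<Longrightarrow> sets (\<mu> n) = sets borel"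
    and "prob_space \<nu>"
    and "sets \<nu> = sets borel"
    and "\<And>x y. c x y = C (dist x y)"
    and "\<And>t. t \<ge> 0 \<Longrightarrow> C t \<ge> 0"
    and "mono_on {0..} C"
    and "continuous_on {0..} C"
    and "C 0 = 0"
    and "\<And>n. n \<ge> 1 \<Longrightarrow> double_moment C a (\<mu> n) < \<infinity>"
    and "double_moment C a \<nu> < \<infinity>"
  shows
    "(converges_weakly \<mu> \<nu> \<and>
        (\<lambda>n. double_moment C a (\<mu> n)) \<longlonglongrightarrow> double_moment C a \<nu> \<longrightarrow>
        (\<lambda>n. transport_dist c (\<mu> n) \<nu>) \<longlonglongrightarrow> 0)
     \<and> ((\<forall>t>0. C t > 0) \<longrightarrow>
        (\<lambda>n. transport_dist c (\<mu> n) \<nu>) \<longlonglongrightarrow> 0 \<longrightarrow> converges_weakly \<mu> \<nu>)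
     \<and> (doubling C \<and> (\<exists>t\<ge>0. C t \<noteq> 0) \<longrightarrow>
        ((\<lambda>n. transport_dist c (\<mu> n) \<nu>) \<longlonglongrightarrow> 0 \<longleftrightarrow>
          converges_weakly \<mu> \<nu> \<and>
          (\<lambda>n. double_moment C a (\<mu> n)) \<longlonglongrightarrow> double_moment C a \<nu>))
     \<and> (doubling C \<longrightarrow>
        (\<forall>b. (\<forall>n\<ge>1. double_moment C b (\<mu> n) < \<infinity>) \<and> double_moment C b \<nu> < \<infinity>))"
proof -
  note \<mu> = assms(1,2) and \<nu> = assms(3,4) and nonneg = assms(6) and mono = assms(7)
    and cont = assms(8) and C0 = assms(9)
  have c: "c = (\<lambda>x y. C (dist x y))" using assms(5) by (intro ext)
  have Cle: "C s \<le> C t" if "0 \<le> s" "s \<le> t" for s t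
    using mono that by (auto simp: mono_on_def)
  let ?g = "\<lambda>x. C (2 * dist x a)"
  have gc: "continuous_on UNIV ?g"
    by (intro continuous_on_compose_half_line[OF cont] continuous_intros) auto
  have int: "integrable M ?g" and mom: "double_moment C a M = ennreal (\<integral>x. ?g x \<partial>M)"
    if "sets M = sets borel" "double_moment C a M < \<infinity>" for M
  proof -
    have m: "?g \<in> borel_measurable M"
      unfolding measurable_cong_sets[OF that(1) refl]
      by (rule borel_measurable_continuous_onI[OF gc])
    show i: "integrable M ?g"
      by (rule integrableI_nonneg[OF m]) (use that(2) nonneg in \<open>auto simp: double_moment_def\<close>)
    show "double_moment C a M = ennreal (\<integral>x. ?g x \<partial>M)"
      unfolding double_moment_def by (rule nn_integral_eq_integral[OF i]) (simp add: nonneg)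
  qed
  note int\<mu> = int[OF \<mu>(2) assms(10)] and int\<nu> = int[OF \<nu>(2) assms(11)]
  have mom_iff: "(\<lambda>n. double_moment C a (\<mu> n)) \<longlonglongrightarrow> double_moment C a \<nu> \<longleftrightarrow>
      (\<lambda>n. \<integral>x. ?g x \<partial>\<mu> n) \<longlonglongrightarrow> (\<integral>x. ?g x \<partial>\<nu>)"
  proof -
    have "(\<lambda>n. double_moment C a (\<mu> n)) \<longlonglongrightarrow> double_moment C a \<nu> \<longleftrightarrow>
        (\<lambda>n. ennreal (\<integral>x. ?g x \<partial>\<mu> n)) \<longlonglongrightarrow> ennreal (\<integral>x. ?g x \<partial>\<nu>)"
      unfolding mom[OF \<nu>(2) assms(11)]
      by (intro tendsto_cong) (auto simp: eventually_sequentially intro!: exI[of _ 1] mom \<mu>(2) assms(10))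
    also have "\<dots> \<longleftrightarrow> (\<lambda>n. \<integral>x. ?g x \<partial>\<mu> n) \<longlonglongrightarrow> (\<integral>x. ?g x \<partial>\<nu>)"
      by (rule tendsto_ennreal_iff) (auto simp: nonneg)
    finally show ?thesis .
  qed
  have 1: "(\<lambda>n. transport_dist c (\<mu> n) \<nu>) \<longlonglongrightarrow> 0"
    if "converges_weakly \<mu> \<nu>" "(\<lambda>n. double_moment C a (\<mu> n)) \<longlonglongrightarrow> double_moment C a \<nu>"
    unfolding c
    by (rule transport_dist_tendsto_0[OF _ _ \<nu> _ mono cont C0 _ int\<nu>])
      (use \<mu> nonneg int\<mu> that mom_iff in auto)
  have 2: "converges_weakly \<mu> \<nu>"
    if pos: "\<And>t. t > 0 \<Longrightarrow> C t > 0" and T: "(\<lambda>n. transport_dist c (\<mu> n) \<nu>) \<longlonglongrightarrow> 0"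
    unfolding converges_weakly_def
  proof (intro allI impI)
    fix f :: "'a \<Rightarrow> real"
    assume f: "continuous_on UNIV f" "bounded (range f)"
    from f(2) obtain B where B: "\<And>x. \<bar>f x\<bar> \<le> B" by (auto simp: bounded_iff)
    interpret \<nu>: prob_space \<nu> by (rule \<nu>)
    show "(\<lambda>n. \<integral>x. f x \<partial>\<mu> n) \<longlonglongrightarrow> (\<integral>x. f x \<partial>\<nu>)"
    proof (rule integral_tendsto_if_transport_dist_tendsto_0[OF \<nu>(2) mono cont C0 pos T[unfolded c] f(1)])
      show "integrable (\<mu> n) f" if "n \<ge> 1" for n
        by (rule integrable_if_bounded_continuous[OF \<mu>(1,2)[OF that] f(1) B])
      show "integrable \<nu> f"
        by (rule integrable_if_bounded_continuous[OF \<nu> f(1) B])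
      show "\<bar>f x - f y\<bar> \<le> 2 * B + 0 * C (dist x y)" for x y
        using B[of x] B[of y] by simp
      show "0 \<le> 2 * B" using B[of a] by simp
    qed auto
  qed
  have 3: "(\<lambda>n. double_moment C a (\<mu> n)) \<longlonglongrightarrow> double_moment C a \<nu>"
    if dbl: "doubling C" and pos: "\<And>t. t > 0 \<Longrightarrow> C t > 0"
      and T: "(\<lambda>n. transport_dist c (\<mu> n) \<nu>) \<longlonglongrightarrow> 0"
  proof -
    obtain l where l: "l > 0" "\<And>y. y \<ge> 0 \<Longrightarrow> C (2 * y) \<le> l * C y"
      using dbl by (auto simp: doubling_def)
    \<comment> \<open>If \<open>x\<close> is within \<open>dist y a\<close> of \<open>y\<close>, then \<open>dist x a\<close> is at most twice \<open>dist y a\<close> and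
    one doubling suffices. Otherwise \<open>dist x a\<close> is at most twice \<open>dist x y\<close>, and doubling is
    used twice.\<close>
    have up: "?g x - ?g y \<le> l * ?g y + l^2 * C (dist x y)" for x y
    proof -
      have nn: "0 \<le> l * ?g y" "0 \<le> l^2 * C (dist x y)" "0 \<le> ?g y" using l nonneg by auto
      show ?thesis
      proof (cases "dist x y \<le> dist y a")
        case True
        then have "?g x \<le> C (2 * (2 * dist y a))"
          using dist_triangle[of x a y] by (intro Cle) auto
        also have "\<dots> \<le> l * ?g y" by (rule l(2)) simp
        finally show ?thesis using nn by linarith
      next
        case False
        then have "?g x \<le> C (2 * (2 * dist x y))"
          using dist_triangle[of x a y] by (intro Cle) auto
        also have "\<dots> \<le> l * C (2 * dist x y)" by (rule l(2)) simp
        also have "\<dots> \<le> l * (l * C (dist x y))" using l by (intro mult_left_mono) auto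
        finally show ?thesis using nn by (simp add: power2_eq_square mult.assoc)
      qed
    qed
    have "(\<lambda>n. \<integral>x. ?g x \<partial>\<mu> n) \<longlonglongrightarrow> (\<integral>x. ?g x \<partial>\<nu>)"
    proof (rule integral_tendsto_if_transport_dist_tendsto_0[OF \<nu>(2) mono cont C0 pos T[unfolded c] gc int\<mu> int\<nu>])
      show "integrable \<nu> (\<lambda>y. (l + 1) * ?g y)" using int\<nu> by simp
      show "\<bar>?g x - ?g y\<bar> \<le> (l + 1) * ?g y + l^2 * C (dist x y)" for x y
      proof -
        have "0 \<le> l * ?g y" "0 \<le> l^2 * C (dist x y)" "0 \<le> ?g y" "0 \<le> ?g x" using l nonneg by auto
        then show ?thesis using up[of x y] by (simp add: abs_le_iff algebra_simps)
      qed
    qed (use l nonneg in auto)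
    then show ?thesis using mom_iff by simp
  qed
  have pos: "C t > 0" if "doubling C" "\<exists>s\<ge>0. C s \<noteq> 0" "t > 0" for t
    using that doubling_pos[OF that(1) mono nonneg] by blast
  have 4: "double_moment C b M < \<infinity>"
    if "doubling C" "prob_space M" "sets M = sets borel" "double_moment C a M < \<infinity>" for b M
    by (rule double_moment_finite_change_base[OF that(2,3,1) mono cont nonneg that(4)])
  show ?thesis
    using 1 2 3 pos 4 \<mu> \<nu> assms(10,11) by blast
qed

end
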